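(* Let $k\in\mathbb{N}$, let $f:[\mathbb{N}]^2\rightarrow\{1,\dots,k\}$ be computable and $\phi:\mathbb{N}\rightarrow\mathbb{N}$ computable with $w\rightarrow(\phi(w))^2_{k+1}$ for all $w$ and $\liminf_w\phi(w)=\infty$, and let $P\gg\emptyset'$. Then there is a set $A\leq_T P$ which is packed for $\phi$ and semi-homogeneous for $f$.
   Context: $[X]^2$ is the set of 2-element subsets of $X$. $w\rightarrow(m)^2_k$ means every $k$-coloring of the 2-element subsets of a $w$-element set has a subset of size $m$ all of whose pairs get the same color. $A$ is packed for $\phi$ if $|A\cap\{1,\dots,w\}|\geq\phi(w)$ for infinitely many $w$. $A$ is semi-homogeneous for $f$ if $f$ takes at most $2$ values on $[A]^2$. $P\gg X$ means $P$ computes an infinite path through every infinite $X$-computable binary tree. *)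

theory Defs
  imports Complex_Main "HOL-Library.Nat_Bijection" "HOL-Library.Sublist"
    "HOL-Library.Ramsey" "HOL-Library.Extended_Nat" "HOL-Library.Liminf_Limsup"
begin

text \<open>
  Kleene's partial recursive functions relative to an oracle set, in the unary presentation:
  tuples are passed as a single number through \<^const>\<open>prod_encode\<close>, and the
  projections and pairing are themselves basic operations. A tuple of arguments
  \<open>(x, y)\<close> is therefore the number \<open>prod_encode (x, y)\<close>.
\<close>

datatype prog =
    PZero | PSucc | PFst | PSnd | POracle
  | PPair prog prog
  | PComp prog prog
  | PRec prog prog
  | PMin prog

text \<open>
  \<open>sem X c n\<close> is the result of running \<open>c\<close> with oracle \<open>X\<close> on input
  \<open>n\<close>, with \<^const>\<open>None\<close> for divergence. The program \<open>PRec c d\<close>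
  computes \<open>h(a, 0) = c(a)\<close>, \<open>h(a, i + 1) = d(a, (i, h(a, i)))\<close>, and
  \<open>PMin c\<close> computes the least \<open>m\<close> with \<open>c(n, m) = 0\<close>, provided that
  \<open>c(n, i)\<close> converges for all \<open>i < m\<close>.
\<close>

primrec sem :: "nat set \<Rightarrow> prog \<Rightarrow> nat \<Rightarrow> nat option" where
  "sem X PZero = (\<lambda>n. Some 0)"
| "sem X PSucc = (\<lambda>n. Some (Suc n))"
| "sem X PFst = (\<lambda>n. Some (fst (prod_decode n)))"
| "sem X PSnd = (\<lambda>n. Some (snd (prod_decode n)))"
| "sem X POracle = (\<lambda>n. Some (of_bool (n \<in> X)))"
| "sem X (PPair c d) = (\<lambda>n. Option.bind (sem X c n) (\<lambda>x.
      Option.bind (sem X d n) (\<lambda>y. Some (prod_encode (x, y)))))"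
| "sem X (PComp c d) = (\<lambda>n. Option.bind (sem X d n) (sem X c))"
| "sem X (PRec c d) = (\<lambda>n. case prod_decode n of (a, m) \<Rightarrow>
      rec_nat (sem X c a)
        (\<lambda>i r. Option.bind r (\<lambda>y. sem X d (prod_encode (a, prod_encode (i, y))))) m)"
| "sem X (PMin c) = (\<lambda>n.
      if \<exists>m. sem X c (prod_encode (n, m)) = Some 0 \<and>
             (\<forall>i<m. sem X c (prod_encode (n, i)) \<noteq> None)
      then Some (LEAST m. sem X c (prod_encode (n, m)) = Some 0)
      else None)"

definition computable_in :: "nat set \<Rightarrow> (nat \<Rightarrow> nat) \<Rightarrow> bool" where
  "computable_in X g \<longleftrightarrow> (\<exists>c. \<forall>n. sem X c n = Some (g n))"

definition computable :: "(nat \<Rightarrow> nat) \<Rightarrow> bool" where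
  "computable g \<longleftrightarrow> computable_in {} g"

definition turing_le :: "nat set \<Rightarrow> nat set \<Rightarrow> bool" (infix "\<le>\<^sub>T" 50) where
  "A \<le>\<^sub>T B \<longleftrightarrow> computable_in B (\<lambda>n. of_bool (n \<in> A))"

primrec prog_encode :: "prog \<Rightarrow> nat" where
  "prog_encode PZero = prod_encode (0, 0)"
| "prog_encode PSucc = prod_encode (1, 0)"
| "prog_encode PFst = prod_encode (2, 0)"
| "prog_encode PSnd = prod_encode (3, 0)"
| "prog_encode POracle = prod_encode (4, 0)"
| "prog_encode (PPair c d) = prod_encode (5, prod_encode (prog_encode c, prog_encode d))"
| "prog_encode (PComp c d) = prod_encode (6, prod_encode (prog_encode c, prog_encode d))"
| "prog_encode (PRec c d) = prod_encode (7, prod_encode (prog_encode c, prog_encode d))"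
| "prog_encode (PMin c) = prod_encode (8, prog_encode c)"

lemma prog_encode_inject: "prog_encode c = prog_encode d \<Longrightarrow> c = d"
proof (induction c arbitrary: d)
qed (case_tac d; force)+

text \<open>
  The Turing jump: the halting set of programs run on their own code. Numbers that are not
  the code of a program are not in the jump.
\<close>

definition jump :: "nat set \<Rightarrow> nat set" where
  "jump X = {prog_encode c | c. sem X c (prog_encode c) \<noteq> None}"

definition binary_tree :: "bool list set \<Rightarrow> bool" where
  "binary_tree T \<longleftrightarrow> (\<forall>\<sigma> \<tau>. \<tau> \<in> T \<longrightarrow> prefix \<sigma> \<tau> \<longrightarrow> \<sigma> \<in> T)"

definition string_encode :: "bool list \<Rightarrow> nat" where
  "string_encode \<sigma> = list_encode (map of_bool \<sigma>)"

text \<open>An infinite path is identified with the set of positions at which it is \<^const>\<open>True\<close>.\<close>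

definition infinite_path :: "nat set \<Rightarrow> bool list set \<Rightarrow> bool" where
  "infinite_path G T \<longleftrightarrow> (\<forall>n. map (\<lambda>i. i \<in> G) [0..<n] \<in> T)"

definition path_degree_over :: "nat set \<Rightarrow> nat set \<Rightarrow> bool" (infix "\<ggreater>" 50) where
  "P \<ggreater> X \<longleftrightarrow>
     (\<forall>T. binary_tree T \<longrightarrow> infinite T \<longrightarrow> string_encode ` T \<le>\<^sub>T X \<longrightarrow>
        (\<exists>G. G \<le>\<^sub>T P \<and> infinite_path G T))"

definition arrows :: "nat \<Rightarrow> nat \<Rightarrow> nat \<Rightarrow> bool" where
  "arrows w m k \<longleftrightarrow> partn {1..w} m 2 {1..k}"

text \<open>
  A function on pairs is computable if its value at \<open>{x, y}\<close> is computable from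
  \<open>x < y\<close>; inputs that do not code such an \<open>(x, y)\<close> are irrelevant.
\<close>

definition computable_on_pairs :: "(nat set \<Rightarrow> nat) \<Rightarrow> bool" where
  "computable_on_pairs f \<longleftrightarrow>
     (\<exists>g. computable g \<and> (\<forall>x y. x < y \<longrightarrow> f {x, y} = g (prod_encode (x, y))))"

definition packed :: "(nat \<Rightarrow> nat) \<Rightarrow> nat set \<Rightarrow> bool" where
  "packed \<phi> A \<longleftrightarrow> infinite {w. \<phi> w \<le> card (A \<inter> {1..w})}"

definition semi_homogeneous :: "(nat set \<Rightarrow> nat) \<Rightarrow> nat set \<Rightarrow> bool" where
  "semi_homogeneous f A \<longleftrightarrow> finite (f ` nsets A 2) \<and> card (f ` nsets A 2) \<le> 2"

end

theory Submission
  imports Defs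
begin

text \<open>
  Classically, let \<open>U\<close> be an ultrafilter all of whose sets contain, for infinitely many \<open>w\<close>, a
  homogeneous subset of \<open>{1..w}\<close> of size \<open>\<phi> w\<close>; the spare colour in the arrow hypothesis
  gives one. Every \<open>x\<close> has a limit colour along \<open>U\<close>, so one can pick successive homogeneous
  blocks, each with one limit colour, inside the set of points at which all earlier blocks have
  attained their limit colours. The colour inside a block and the colour from it to later blocks
  can be made constant by passing to infinitely many blocks.

  Effectively, membership in some such \<open>U\<close> is replaced by largeness: every finite partition has a
  part containing blocks arbitrarily far out. For the computable reservoirs of the construction
  this is a \<open>\<Pi>\<^sub>1\<close> statement relative to the jump, and a bound on the candidates for the next block
  can be computed. An oracle above the jump can choose a true one from finitely many such
  statements at least one of which is true, hence it computes the sequence of blocks.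
\<close>

section \<open>Closure properties of the computable functions\<close>

abbreviation nfst :: "nat \<Rightarrow> nat" where "nfst n \<equiv> fst (prod_decode n)"
abbreviation nsnd :: "nat \<Rightarrow> nat" where "nsnd n \<equiv> snd (prod_decode n)"

text \<open>Nothing is asked of the program outside \<open>D\<close>: the search for a bound on the
  next block is only known to terminate at states with a large reservoir.\<close>

definition computable_on :: "nat set \<Rightarrow> nat set \<Rightarrow> (nat \<Rightarrow> nat) \<Rightarrow> bool" where
  "computable_on X D g \<longleftrightarrow> (\<exists>c. \<forall>n\<in>D. sem X c n = Some (g n))"

definition decidable_in :: "nat set \<Rightarrow> (nat \<Rightarrow> bool) \<Rightarrow> bool" where
  "decidable_in X p \<longleftrightarrow> computable_in X (\<lambda>n. of_bool (p n))"

lemma computable_on_UNIV: "computable_on X UNIV g \<longleftrightarrow> computable_in X g"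
  by (simp add: computable_on_def computable_in_def)

lemma computable_in_imp_on: "computable_in X g \<Longrightarrow> computable_on X D g"
  by (auto simp: computable_on_def computable_in_def)

lemma turing_le_iff: "A \<le>\<^sub>T B \<longleftrightarrow> decidable_in B (\<lambda>n. n \<in> A)"
  by (simp add: turing_le_def decidable_in_def)

lemma computable_on_comp:
  assumes "computable_on X E g" and "computable_on X D h" and "\<And>n. n \<in> D \<Longrightarrow> h n \<in> E"
  shows "computable_on X D (\<lambda>n. g (h n))"
proof -
  obtain c d where "\<forall>n\<in>E. sem X c n = Some (g n)" "\<forall>n\<in>D. sem X d n = Some (h n)"
    using assms by (auto simp: computable_on_def)
  then have "\<forall>n\<in>D. sem X (PComp c d) n = Some (g (h n))"
    using assms(3) by simp
  then show ?thesis unfolding computable_on_def by blast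
qed

lemma computable_on_pair:
  assumes "computable_on X D g" and "computable_on X D h"
  shows "computable_on X D (\<lambda>n. prod_encode (g n, h n))"
proof -
  obtain c d where "\<forall>n\<in>D. sem X c n = Some (g n)" "\<forall>n\<in>D. sem X d n = Some (h n)"
    using assms by (auto simp: computable_on_def)
  then have "\<forall>n\<in>D. sem X (PPair c d) n = Some (prod_encode (g n, h n))"
    by simp
  then show ?thesis unfolding computable_on_def by blast
qed

lemma computable_in_comp:
  "computable_in X g \<Longrightarrow> computable_in X h \<Longrightarrow> computable_in X (\<lambda>n. g (h n))"
  using computable_on_comp[of X UNIV g UNIV h] by (simp add: computable_on_UNIV)

lemma computable_in_pair:
  "computable_in X g \<Longrightarrow> computable_in X h \<Longrightarrow> computable_in X (\<lambda>n. prod_encode (g n, h n))"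
  using computable_on_pair[of X UNIV g h] by (simp add: computable_on_UNIV)

lemma computable_in_sem: "(\<And>n. sem X c n = Some (g n)) \<Longrightarrow> computable_in X g"
  by (auto simp: computable_in_def)

lemma computable_in_id: "computable_in X (\<lambda>n. n)"
  by (rule computable_in_sem[of _ "PPair PFst PSnd"]) simp

lemma computable_in_fst: "computable_in X g \<Longrightarrow> computable_in X (\<lambda>n. nfst (g n))"
  by (rule computable_in_comp[of X nfst]) (rule computable_in_sem[of _ PFst], simp)

lemma computable_in_snd: "computable_in X g \<Longrightarrow> computable_in X (\<lambda>n. nsnd (g n))"
  by (rule computable_in_comp[of X nsnd]) (rule computable_in_sem[of _ PSnd], simp)

lemma computable_in_Suc: "computable_in X g \<Longrightarrow> computable_in X (\<lambda>n. Suc (g n))"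
  by (rule computable_in_comp[of X Suc]) (rule computable_in_sem[of _ PSucc], simp)

primrec const_prog :: "nat \<Rightarrow> prog" where
  "const_prog 0 = PZero"
| "const_prog (Suc a) = PComp PSucc (const_prog a)"

lemma sem_const_prog: "sem X (const_prog a) n = Some a"
  by (induction a) auto

lemma computable_in_const: "computable_in X (\<lambda>n. a)"
  by (rule computable_in_sem[of _ "const_prog a"]) (simp add: sem_const_prog)

text \<open>\<open>PRec\<close> is run with the whole input \<open>n\<close> as its parameter, so
  that the step \<open>S n\<close> may depend on it; the number \<open>g n\<close> of rounds is
  paired with \<open>n\<close> at the end.\<close>

lemma computable_in_rec:
  assumes "computable_in X f" and "computable_in X g"
    and "computable_in X (\<lambda>z. S (nfst z) (nfst (nsnd z)) (nsnd (nsnd z)))"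
  shows "computable_in X (\<lambda>n. rec_nat (f n) (S n) (g n))"
proof -
  obtain c e where c: "\<And>n. sem X c n = Some (f n)"
    and e: "\<And>n. sem X e n = Some (S (nfst n) (nfst (nsnd n)) (nsnd (nsnd n)))"
    using assms(1,3) by (auto simp: computable_in_def)
  have "rec_nat (Some (f n)) (\<lambda>i r. Option.bind r (\<lambda>y. sem X e (prod_encode (n, prod_encode (i, y))))) m
      = Some (rec_nat (f n) (S n) m)" for n m
    by (induction m) (auto simp: e)
  then have "computable_in X (\<lambda>z. rec_nat (f (nfst z)) (S (nfst z)) (nsnd z))"
    by (intro computable_in_sem[of _ "PRec c e"]) (simp add: c split: prod.split)
  from computable_in_comp[OF this computable_in_pair[OF computable_in_id assms(2)]]
  show ?thesis by simp
qed

text \<open>The iteration never leaves \<open>D\<close>, so a program that is correct only on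
  \<open>D\<close> yields a total function.\<close>

lemma computable_on_iterate:
  assumes g: "computable_on X D g" and a: "a \<in> D" and D: "\<And>t. t \<in> D \<Longrightarrow> g t \<in> D"
  shows "computable_in X (\<lambda>n. (g ^^ n) a)"
proof -
  obtain c where c: "\<And>n. n \<in> D \<Longrightarrow> sem X c n = Some (g n)"
    using g by (auto simp: computable_on_def)
  have "(g ^^ n) a \<in> D" for n
    by (induction n) (auto simp: a D)
  then have "rec_nat (Some a) (\<lambda>i r. Option.bind r (\<lambda>y. sem X (PComp c (PComp PSnd PSnd))
      (prod_encode (m, prod_encode (i, y))))) n = Some ((g ^^ n) a)" for n m
    by (induction n) (auto simp: c)
  then have "computable_in X (\<lambda>z. (g ^^ (nsnd z)) a)"
    by (intro computable_in_sem[of _ "PRec (const_prog a) (PComp c (PComp PSnd PSnd))"])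
      (simp add: sem_const_prog split: prod.split)
  from computable_in_comp[OF this computable_in_pair[OF computable_in_id computable_in_id]]
  show ?thesis by simp
qed

section \<open>Arithmetic\<close>

lemma computable_in_add:
  assumes "computable_in X f" and "computable_in X g"
  shows "computable_in X (\<lambda>n. f n + g n)"
proof -
  have "rec_nat a (\<lambda>i y. Suc y) b = a + b" for a b :: nat
    by (induction b) auto
  then show ?thesis
    using computable_in_rec[OF assms, of "\<lambda>n i y. Suc y"]
    by (simp add: computable_in_Suc computable_in_snd computable_in_id)
qed

lemma computable_in_mult:
  assumes "computable_in X f" and "computable_in X g"
  shows "computable_in X (\<lambda>n. f n * g n)"
proof -
  have "rec_nat 0 (\<lambda>i y. y + a) b = a * b" for a b :: nat
    by (induction b) auto
  moreover have "computable_in X (\<lambda>z. nsnd (nsnd z) + f (nfst z))"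
    by (intro computable_in_add computable_in_snd computable_in_id
        computable_in_comp[OF assms(1)] computable_in_fst)
  ultimately show ?thesis
    using computable_in_rec[OF computable_in_const assms(2), of "\<lambda>n i y. y + f n" 0] by simp
qed

lemma computable_in_diff:
  assumes "computable_in X f" and "computable_in X g"
  shows "computable_in X (\<lambda>n. f n - g n)"
proof -
  \<comment> \<open>Recursion returning its counter gives the predecessor, with 0 going to 0; its
    iterates give truncated subtraction.\<close>
  have "rec_nat 0 (\<lambda>i y. i) b = b - 1" for b :: nat
    by (cases b) auto
  then have pred: "computable_in X (\<lambda>n. n - 1)"
    using computable_in_rec[OF computable_in_const computable_in_id, of X "\<lambda>n i y. i" 0]
    by (simp add: computable_in_fst computable_in_snd computable_in_id)
  have "rec_nat a (\<lambda>i y. y - 1) b = a - b" for a b :: nat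
    by (induction b) auto
  moreover have "computable_in X (\<lambda>z. nsnd (nsnd z) - 1)"
    by (intro computable_in_comp[OF pred] computable_in_snd computable_in_id)
  ultimately show ?thesis
    using computable_in_rec[OF assms, of "\<lambda>n i y. y - 1"] by simp
qed

lemma computable_in_power:
  assumes "computable_in X f" and "computable_in X g"
  shows "computable_in X (\<lambda>n. f n ^ g n)"
proof -
  have "rec_nat 1 (\<lambda>i y. y * a) b = a ^ b" for a b :: nat
    by (induction b) auto
  moreover have "computable_in X (\<lambda>z. nsnd (nsnd z) * f (nfst z))"
    by (intro computable_in_mult computable_in_snd computable_in_id
        computable_in_comp[OF assms(1)] computable_in_fst)
  ultimately show ?thesis
    using computable_in_rec[OF computable_in_const assms(2), of "\<lambda>n i y. y * f n" 1] by simp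
qed

lemmas computable_arith = computable_in_id computable_in_const computable_in_fst
  computable_in_snd computable_in_pair computable_in_Suc computable_in_add computable_in_mult
  computable_in_diff computable_in_power

section \<open>Decidable predicates, bounded quantifiers and search\<close>

lemma decidable_in_comp:
  "decidable_in X p \<Longrightarrow> computable_in X h \<Longrightarrow> decidable_in X (\<lambda>n. p (h n))"
  unfolding decidable_in_def by (rule computable_in_comp)

lemma decidable_in_const: "decidable_in X (\<lambda>n. b)"
  unfolding decidable_in_def by (rule computable_in_const)

lemma decidable_in_not: "decidable_in X p \<Longrightarrow> decidable_in X (\<lambda>n. \<not> p n)"
proof -
  assume "decidable_in X p"
  moreover have "(\<lambda>n. of_bool (\<not> p n)) = (\<lambda>n. 1 - of_bool (p n) :: nat)" by auto
  ultimately show ?thesis unfolding decidable_in_def by (auto intro: computable_arith)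
qed

lemma decidable_in_conj:
  "decidable_in X p \<Longrightarrow> decidable_in X q \<Longrightarrow> decidable_in X (\<lambda>n. p n \<and> q n)"
  unfolding decidable_in_def of_bool_conj by (intro computable_arith)

lemma decidable_in_disj:
  assumes "decidable_in X p" and "decidable_in X q"
  shows "decidable_in X (\<lambda>n. p n \<or> q n)"
proof -
  have "decidable_in X (\<lambda>n. \<not> (\<not> p n \<and> \<not> q n))"
    by (intro decidable_in_not decidable_in_conj assms)
  then show ?thesis by simp
qed

lemma decidable_in_imp:
  assumes "decidable_in X p" and "decidable_in X q"
  shows "decidable_in X (\<lambda>n. p n \<longrightarrow> q n)"
  unfolding imp_conv_disj by (intro decidable_in_not decidable_in_disj assms)

lemma decidable_in_le:
  assumes "computable_in X f" and "computable_in X g"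
  shows "decidable_in X (\<lambda>n. f n \<le> g n)"
proof -
  have "(\<lambda>n. of_bool (f n \<le> g n)) = (\<lambda>n. 1 - (f n - g n))" by auto
  then show ?thesis
    unfolding decidable_in_def using assms by (auto intro: computable_arith)
qed

lemma decidable_in_less:
  assumes "computable_in X f" and "computable_in X g"
  shows "decidable_in X (\<lambda>n. f n < g n)"
  unfolding not_le[symmetric] by (intro decidable_in_not decidable_in_le assms)

lemma decidable_in_eq:
  fixes f g :: "nat \<Rightarrow> nat"
  assumes "computable_in X f" and "computable_in X g"
  shows "decidable_in X (\<lambda>n. f n = g n)"
  unfolding eq_iff by (intro decidable_in_conj decidable_in_le assms)

lemma computable_in_if:
  assumes "decidable_in X p" and "computable_in X f" and "computable_in X g"
  shows "computable_in X (\<lambda>n. if p n then f n else g n)"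
proof -
  have "(\<lambda>n. if p n then f n else g n) = (\<lambda>n. of_bool (p n) * f n + (1 - of_bool (p n)) * g n)"
    by auto
  then show ?thesis
    using assms unfolding decidable_in_def by (auto intro!: computable_arith)
qed

lemma decidable_in_bex:
  assumes "computable_in X b" and "decidable_in X (\<lambda>z. P (nfst z) (nsnd z))"
  shows "decidable_in X (\<lambda>n. \<exists>i<b n. P n i)"
proof -
  have "rec_nat 0 (\<lambda>i y. if y = 1 \<or> P n i then 1 else 0) m = (of_bool (\<exists>i<m. P n i) :: nat)" for n m
    by (induction m) (auto simp: less_Suc_eq)
  moreover have "decidable_in X (\<lambda>z. P (nfst z) (nfst (nsnd z)))"
    using decidable_in_comp[OF assms(2), of "\<lambda>z. prod_encode (nfst z, nfst (nsnd z))"]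
    by (simp add: computable_arith)
  then have "computable_in X (\<lambda>z. if nsnd (nsnd z) = 1 \<or> P (nfst z) (nfst (nsnd z)) then 1 else 0)"
    by (intro computable_in_if decidable_in_disj decidable_in_eq computable_arith)
  ultimately show ?thesis
    using computable_in_rec[OF computable_in_const assms(1), of "\<lambda>n i y. if y = 1 \<or> P n i then 1 else 0" 0]
    by (simp add: decidable_in_def)
qed

lemma decidable_in_ball:
  assumes "computable_in X b" and "decidable_in X (\<lambda>z. P (nfst z) (nsnd z))"
  shows "decidable_in X (\<lambda>n. \<forall>i<b n. P n i)"
  using decidable_in_not[OF decidable_in_bex[OF assms(1) decidable_in_not[OF assms(2)]]] by simp

lemma decidable_in_bex_le:
  assumes "computable_in X b" and "decidable_in X (\<lambda>z. P (nfst z) (nsnd z))"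
  shows "decidable_in X (\<lambda>n. \<exists>i\<le>b n. P n i)"
  using decidable_in_bex[OF computable_in_Suc[OF assms(1)] assms(2)] by (simp add: less_Suc_eq_le)

lemma decidable_in_ball_le:
  assumes "computable_in X b" and "decidable_in X (\<lambda>z. P (nfst z) (nsnd z))"
  shows "decidable_in X (\<lambda>n. \<forall>i\<le>b n. P n i)"
  using decidable_in_ball[OF computable_in_Suc[OF assms(1)] assms(2)] by (simp add: less_Suc_eq_le)

lemma computable_on_Least:
  assumes "decidable_in X (\<lambda>z. P (nfst z) (nsnd z))" and "\<And>n. n \<in> D \<Longrightarrow> \<exists>m. P n m"
  shows "computable_on X D (\<lambda>n. LEAST m. P n m)"
proof -
  \<comment> \<open>\<open>PMin\<close> looks for the value 0, so the program has to decide the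
    negation of \<open>P\<close>.\<close>
  obtain c where c: "\<And>z. sem X c z = Some (of_bool (\<not> P (nfst z) (nsnd z)))"
    using decidable_in_not[OF assms(1)] by (auto simp: decidable_in_def computable_in_def)
  have "sem X (PMin c) n = Some (LEAST m. P n m)" if "n \<in> D" for n
    using assms(2)[OF that] by (auto simp: c)
  then show ?thesis unfolding computable_on_def by blast
qed

lemma computable_in_Least:
  assumes "decidable_in X (\<lambda>z. P (nfst z) (nsnd z))" and "\<And>n. \<exists>m. P n m"
  shows "computable_in X (\<lambda>n. LEAST m. P n m)"
  using computable_on_Least[of X P UNIV] assms by (simp add: computable_on_UNIV)

lemma computable_in_div:
  assumes "computable_in X f" and "computable_in X g"
  shows "computable_in X (\<lambda>n. f n div g n)"
proof -
  \<comment> \<open>The disjunct \<open>g n = 0\<close> stops the search at 0, which is the value of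
    division by zero.\<close>
  have "f n div g n = (LEAST q. g n = 0 \<or> f n < (q + 1) * g n)" for n
  proof (rule Least_equality[symmetric])
    show "g n = 0 \<or> f n < (f n div g n + 1) * g n"
      using dividend_less_div_times[of "g n" "f n"] by auto
  next
    fix q assume "g n = 0 \<or> f n < (q + 1) * g n"
    then show "f n div g n \<le> q"
      by (cases "g n = 0") (auto simp: less_mult_imp_div_less less_Suc_eq_le[symmetric])
  qed
  moreover have "computable_in X (\<lambda>n. LEAST q. g n = 0 \<or> f n < (q + 1) * g n)"
  proof (intro computable_in_Least decidable_in_disj decidable_in_eq decidable_in_less computable_arith
      computable_in_comp[OF assms(1)] computable_in_comp[OF assms(2)])
    fix n
    have "f n < (f n + 1) * g n" if "g n \<noteq> 0"
      using that by (cases "g n") auto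
    then show "\<exists>q. g n = 0 \<or> f n < (q + 1) * g n" by (cases "g n = 0") auto
  qed
  ultimately show ?thesis by simp
qed

lemma computable_in_mod:
  "computable_in X f \<Longrightarrow> computable_in X g \<Longrightarrow> computable_in X (\<lambda>n. f n mod g n)"
  unfolding minus_div_mult_eq_mod[symmetric] by (intro computable_arith computable_in_div)

lemma decidable_in_set_decode:
  "computable_in X f \<Longrightarrow> computable_in X g \<Longrightarrow> decidable_in X (\<lambda>n. f n \<in> set_decode (g n))"
  unfolding set_decode_def mem_Collect_eq odd_iff_mod_2_eq_one
  by (intro decidable_in_eq computable_in_mod computable_in_div computable_arith)

lemmas computable_intros = computable_arith computable_in_div computable_in_mod computable_in_if
  decidable_in_const decidable_in_not decidable_in_conj decidable_in_disj decidable_in_imp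
  decidable_in_le decidable_in_less decidable_in_eq decidable_in_bex decidable_in_ball
  decidable_in_bex_le decidable_in_ball_le decidable_in_set_decode

text \<open>Turns quantifiers over a coded set into bounded ones, which preserve
  decidability.\<close>

lemma less_of_mem_set_decode: "x \<in> set_decode n \<Longrightarrow> x < n"
proof -
  assume "x \<in> set_decode n"
  then have "n div 2 ^ x \<noteq> 0" unfolding set_decode_def by (metis mem_Collect_eq even_zero)
  then have "2 ^ x \<le> n" by (simp add: div_eq_0_iff)
  then show ?thesis using less_exp[of x] by linarith
qed

lemma computable_in_card_set_decode:
  assumes "computable_in X g"
  shows "computable_in X (\<lambda>n. card (set_decode (g n)))"
proof -
  have "rec_nat 0 (\<lambda>i y. if i \<in> set_decode h then Suc y else y) m
      = card (set_decode h \<inter> {..<m})" for h m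
    by (induction m) (auto simp: lessThan_Suc)
  moreover have "set_decode h \<inter> {..<h} = set_decode h" for h
    using less_of_mem_set_decode by auto
  moreover have "computable_in X (\<lambda>z. if nfst (nsnd z) \<in> set_decode (g (nfst z))
      then Suc (nsnd (nsnd z)) else nsnd (nsnd z))"
    by (intro computable_intros computable_in_comp[OF assms])
  ultimately show ?thesis
    using computable_in_rec[OF computable_in_const assms,
        of "\<lambda>n i y. if i \<in> set_decode (g n) then Suc y else y" 0] by simp
qed

section \<open>Change of oracle\<close>

lemma turing_le_sem:
  assumes "Y \<le>\<^sub>T X"
  shows "\<exists>c'. sem X c' = sem Y c"
proof (induction c)
  case POracle
  \<comment> \<open>A query to \<open>Y\<close> is answered by a program that decides
    \<open>Y\<close> from \<open>X\<close>; all other constructors are copied.\<close>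
  then show ?case using assms by (auto simp: turing_le_def computable_in_def)
next
  case (PPair c d)
  then obtain c' d' where "sem X c' = sem Y c" "sem X d' = sem Y d" by blast
  then have "sem X (PPair c' d') = sem Y (PPair c d)" by simp
  then show ?case by blast
next
  case (PComp c d)
  then obtain c' d' where "sem X c' = sem Y c" "sem X d' = sem Y d" by blast
  then have "sem X (PComp c' d') = sem Y (PComp c d)" by simp
  then show ?case by blast
next
  case (PRec c d)
  then obtain c' d' where "sem X c' = sem Y c" "sem X d' = sem Y d" by blast
  then have "sem X (PRec c' d') = sem Y (PRec c d)" by simp
  then show ?case by blast
next
  case (PMin c)
  then obtain c' where "sem X c' = sem Y c" by blast
  then have "sem X (PMin c') = sem Y (PMin c)" by (simp only: sem.simps)
  then show ?case by blast
next
  case PZero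
  have "sem X PZero = sem Y PZero" by simp
  then show ?case by blast
next
  case PSucc
  have "sem X PSucc = sem Y PSucc" by simp
  then show ?case by blast
next
  case PFst
  have "sem X PFst = sem Y PFst" by simp
  then show ?case by blast
next
  case PSnd
  have "sem X PSnd = sem Y PSnd" by simp
  then show ?case by blast
qed

lemma computable_on_trans:
  assumes "computable_on Y D g" and "Y \<le>\<^sub>T X"
  shows "computable_on X D g"
  using assms(1) turing_le_sem[OF assms(2)] unfolding computable_on_def by metis

lemma computable_in_trans:
  "computable_in Y g \<Longrightarrow> Y \<le>\<^sub>T X \<Longrightarrow> computable_in X g"
  using computable_on_trans[of Y UNIV g X] by (simp add: computable_on_UNIV)

lemma decidable_in_trans:
  "decidable_in Y p \<Longrightarrow> Y \<le>\<^sub>T X \<Longrightarrow> decidable_in X p"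
  unfolding decidable_in_def by (rule computable_in_trans)

lemma empty_turing_le: "{} \<le>\<^sub>T X"
  by (simp add: turing_le_def computable_in_const)

lemma computable_imp_computable_in: "computable g \<Longrightarrow> computable_in X g"
  unfolding computable_def by (rule computable_in_trans[OF _ empty_turing_le])

lemma computable_in_oracle:
  "computable_in X g \<Longrightarrow> decidable_in X (\<lambda>n. g n \<in> X)"
  unfolding decidable_in_def
  by (rule computable_in_comp[of X "\<lambda>n. of_bool (n \<in> X)"]) (rule computable_in_sem[of _ POracle], simp)

section \<open>Choosing between true statements\<close>

text \<open>A program that ignores its input and searches for a witness \<open>B\<close> for
  \<open>a\<close> halts on its own code iff there is one. Its code is computable from
  \<open>a\<close>, so one query to the jump answers the question.\<close>

lemma decidable_in_jump_ex:
  assumes "decidable_in X (\<lambda>z. Q (nfst z) (nsnd z))"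
  shows "decidable_in (jump X) (\<lambda>a. \<exists>B. Q a B)"
proof -
  obtain c where c: "\<And>z. sem X c z = Some (of_bool (\<not> Q (nfst z) (nsnd z)))"
    using decidable_in_not[OF assms] by (auto simp: decidable_in_def computable_in_def)
  define e where "e a = PComp (PMin c) (const_prog a)" for a
  have "sem X (e a) n \<noteq> None \<longleftrightarrow> (\<exists>B. Q a B)" for a n
    by (auto simp: e_def sem_const_prog c)
  then have "(\<exists>B. Q a B) \<longleftrightarrow> prog_encode (e a) \<in> jump X" for a
    unfolding jump_def using prog_encode_inject by blast
  moreover have "prog_encode (const_prog a) = rec_nat (prog_encode PZero)
      (\<lambda>i y. prod_encode (6, prod_encode (prog_encode PSucc, y))) a" for a
    by (induction a) auto
  then have "computable_in (jump X) (\<lambda>a. prog_encode (e a))"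
    unfolding e_def prog_encode.simps(7) by (auto intro!: computable_arith computable_in_rec)
  ultimately show ?thesis
    by (simp add: computable_in_oracle)
qed

section \<open>Computable access to codes of lists\<close>

definition code_drop :: "nat \<Rightarrow> nat \<Rightarrow> nat" where
  "code_drop i n = rec_nat n (\<lambda>i m. nsnd (m - 1)) i"

definition code_nth :: "nat \<Rightarrow> nat \<Rightarrow> nat" where
  "code_nth i n = nfst (code_drop i n - 1)"

definition code_length :: "nat \<Rightarrow> nat" where
  "code_length n = (LEAST i. code_drop i n = 0)"

text \<open>The code of a nonempty list is the successor of the pair of its head and the code of its
  tail. The empty list has code 0, and a further drop stays there because 0 also codes the pair (0,
  0).\<close>

lemma code_drop_list_encode: "code_drop i (list_encode xs) = list_encode (drop i xs)"
proof (induction i)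
  case (Suc i)
  have "nsnd 0 = 0"
    using prod_encode_inverse[of "(0, 0)"] by (simp add: prod_encode_def)
  then have "nsnd (list_encode ys - 1) = list_encode (tl ys)" for ys
    by (cases ys) auto
  with Suc show ?case
    by (simp add: code_drop_def drop_Suc tl_drop)
qed (simp add: code_drop_def)

lemma list_encode_eq_0_iff: "list_encode xs = 0 \<longleftrightarrow> xs = []"
  by (cases xs) auto

lemma code_length_list_encode: "code_length (list_encode xs) = length xs"
  unfolding code_length_def code_drop_list_encode list_encode_eq_0_iff
  by (rule Least_equality) auto

lemma code_nth_list_encode: "i < length xs \<Longrightarrow> code_nth i (list_encode xs) = xs ! i"
  by (simp add: code_nth_def code_drop_list_encode Cons_nth_drop_Suc[symmetric])

lemma computable_in_code_drop:
  assumes "computable_in X f" and "computable_in X g"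
  shows "computable_in X (\<lambda>n. code_drop (f n) (g n))"
  unfolding code_drop_def by (intro computable_in_rec computable_arith assms)

lemma computable_in_code_nth:
  assumes "computable_in X f" and "computable_in X g"
  shows "computable_in X (\<lambda>n. code_nth (f n) (g n))"
  unfolding code_nth_def by (intro computable_in_code_drop computable_arith assms)

lemma computable_in_code_length:
  assumes "computable_in X g"
  shows "computable_in X (\<lambda>n. code_length (g n))"
proof -
  have "\<exists>i. code_drop i n = 0" for n
    using code_drop_list_encode[of "length (list_decode n)" "list_decode n"] by auto
  then show ?thesis
    unfolding code_length_def
    by (intro computable_in_Least decidable_in_eq computable_in_code_drop computable_arith
        computable_in_comp[OF assms]) auto
qed

text \<open>At the position coding \<open>(a, b)\<close>, a node of the tree must not choose a statement that is
  refuted strictly before the other one; the search for refutations is bounded by the length of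
  the node, so that the tree is decidable.\<close>

lemma path_degree_over_choice:
  assumes P: "P \<ggreater> X" and E: "decidable_in X (\<lambda>z. E (nfst z) (nsnd z))"
  obtains G where "G \<le>\<^sub>T P"
    and "\<And>a b. (\<forall>i. E a i) \<or> (\<forall>i. E b i) \<Longrightarrow> \<forall>i. E (if prod_encode (a, b) \<in> G then b else a) i"
proof -
  \<comment> \<open>A tie counts for neither side, which makes the two constraints in
    \<open>ok\<close> compatible.\<close>
  define before where "before a b n \<longleftrightarrow> (\<exists>i<n. \<not> E a i \<and> (\<forall>j\<le>i. E b j))" for a b and n :: nat
  have mono: "before a b n \<Longrightarrow> n \<le> n' \<Longrightarrow> before a b n'" for a b n n'
    unfolding before_def by (meson less_le_trans)
  have excl: "\<not> (before a b n \<and> before b a n)" for a b n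
    unfolding before_def by (meson nat_le_linear)
  define ok where "ok n z v \<longleftrightarrow> (before (nfst z) (nsnd z) n \<longrightarrow> v) \<and> (before (nsnd z) (nfst z) n \<longrightarrow> \<not> v)"
    for n z v
  define T where "T = {\<tau>. \<forall>z<length \<tau>. ok (length \<tau>) z (\<tau> ! z)}"
  \<comment> \<open>A longer node has seen more refutations, so by \<open>mono\<close> it obeys all
    constraints on its initial segments.\<close>
  have "binary_tree T"
    unfolding binary_tree_def T_def ok_def
    by (auto simp: prefix_def nth_append) (metis mono le_add1 trans_less_add1)+
  moreover have "infinite T"
  proof -
    \<comment> \<open>One node of each length: choose \<open>b\<close> exactly when \<open>a\<close>
      is seen to be refuted first.\<close>
    let ?\<tau> = "\<lambda>n. map (\<lambda>z. before (nfst z) (nsnd z) n) [0..<n]"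
    have "?\<tau> n \<in> T" for n
      using excl by (auto simp: T_def ok_def)
    moreover have "inj ?\<tau>"
      by (rule inj_on_inverseI[of _ length]) simp
    ultimately show ?thesis
      by (metis (no_types, lifting) image_subsetI infinite_UNIV_nat finite_subset finite_imageD)
  qed
  moreover have "string_encode ` T \<le>\<^sub>T X"
  proof -
    \<comment> \<open>The condition \<open>code_nth z n \<le> 1\<close> selects the codes of lists
      of truth values.\<close>
    let ?R = "\<lambda>n. \<forall>z<code_length n. code_nth z n \<le> 1 \<and> ok (code_length n) z (code_nth z n = 1)"
    have "list_encode xs \<in> string_encode ` T \<longleftrightarrow> ?R (list_encode xs)" for xs
    proof
      assume "list_encode xs \<in> string_encode ` T"
      then obtain \<tau> where "\<tau> \<in> T" "xs = map of_bool \<tau>"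
        by (auto simp: string_encode_def list_encode_eq)
      then show "?R (list_encode xs)"
        by (auto simp: T_def code_length_list_encode code_nth_list_encode)
    next
      assume R: "?R (list_encode xs)"
      have "xs = map of_bool (map (\<lambda>v. v = 1) xs)"
        using R by (intro nth_equalityI)
          (auto simp: code_length_list_encode code_nth_list_encode le_Suc_eq)
      moreover have "map (\<lambda>v. v = 1) xs \<in> T"
        using R by (auto simp: T_def code_length_list_encode code_nth_list_encode)
      ultimately show "list_encode xs \<in> string_encode ` T"
        unfolding string_encode_def by (metis imageI)
    qed
    then have "n \<in> string_encode ` T \<longleftrightarrow> ?R n" for n
      by (metis list_decode_inverse)
    moreover have dE: "decidable_in X (\<lambda>n. E (f n) (g n))"
      if "computable_in X f" "computable_in X g" for f g
      using decidable_in_comp[OF E computable_in_pair[OF that]] by simp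
    have dbefore: "decidable_in X (\<lambda>n. before (f n) (g n) (h n))"
      if "computable_in X f" "computable_in X g" "computable_in X h" for f g h
      unfolding before_def
      by (intro computable_intros dE that[THEN computable_in_comp])
    have "decidable_in X ?R"
      unfolding ok_def by (intro computable_intros dbefore computable_in_code_length computable_in_code_nth)
    ultimately show ?thesis
      by (simp add: turing_le_iff)
  qed
  ultimately obtain G where G: "G \<le>\<^sub>T P" "infinite_path G T"
    using P unfolding path_degree_over_def by blast
  \<comment> \<open>All initial segments beyond position \<open>z\<close> restrict the same bit, so
    the path respects refutations found at any stage.\<close>
  have ok: "ok n z (z \<in> G)" if "z < n" for n z
    using G(2) that by (auto simp: infinite_path_def T_def)
  have "\<forall>i. E (if prod_encode (a, b) \<in> G then b else a) i"
    if ab: "(\<forall>i. E a i) \<or> (\<forall>i. E b i)" for a b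
  proof (rule ccontr)
    assume not: "\<not> ?thesis"
    show False
    proof (cases "prod_encode (a, b) \<in> G")
      case True
      then obtain i where "\<not> E b i" "\<forall>j. E a j" using not ab by auto
      \<comment> \<open>The length exceeds both the stage \<open>i\<close> of the refutation and the
        position of the pair.\<close>
      then have "before b a (Suc (i + prod_encode (a, b)))"
        by (auto simp: before_def intro!: exI[of _ i])
      then show False
        using ok[of "prod_encode (a, b)" "Suc (i + prod_encode (a, b))"] True by (simp add: ok_def)
    next
      case False
      then obtain i where "\<not> E a i" "\<forall>j. E b j" using not ab by auto
      then have "before a b (Suc (i + prod_encode (a, b)))"
        by (auto simp: before_def intro!: exI[of _ i])
      then show False
        using ok[of "prod_encode (a, b)" "Suc (i + prod_encode (a, b))"] False by (simp add: ok_def)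
    qed
  qed
  with G(1) show thesis by (rule that)
qed

text \<open>A knockout tournament among the candidates below the bound \<open>N t\<close>, each match being
  decided by the oracle of the previous lemma, selects a good one.\<close>

lemma dependent_choice_computable:
  fixes Q :: "nat \<Rightarrow> nat \<Rightarrow> nat \<Rightarrow> bool"
  assumes P: "P \<ggreater> jump {}"
    and Q: "decidable_in {} (\<lambda>z. Q (nfst z) (nfst (nsnd z)) (nsnd (nsnd z)))"
    and N: "computable_on {} D N"
    and nx: "computable_in {} nx"
    and t0: "t0 \<in> D"
    and ex: "\<And>t. t \<in> D \<Longrightarrow> \<exists>u<N t. \<forall>i. \<exists>B. Q (prod_encode (t, u)) i B"
    and step: "\<And>t u. t \<in> D \<Longrightarrow> \<forall>i. \<exists>B. Q (prod_encode (t, u)) i B \<Longrightarrow> nx (prod_encode (t, u)) \<in> D"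
  shows "\<exists>s. computable_in P s \<and> s 0 = t0 \<and> (\<forall>j. s j \<in> D \<and>
    (\<exists>u. (\<forall>i. \<exists>B. Q (prod_encode (s j, u)) i B) \<and> s (Suc j) = nx (prod_encode (s j, u))))"
proof -
  define good where "good a \<longleftrightarrow> (\<forall>i. \<exists>B. Q a i B)" for a
  have "decidable_in {} (\<lambda>z. Q (nfst (nfst z)) (nsnd (nfst z)) (nsnd z))"
    using decidable_in_comp[OF Q, of "\<lambda>z. prod_encode (nfst (nfst z), prod_encode (nsnd (nfst z), nsnd z))"]
    by (simp add: computable_arith)
  \<comment> \<open>The jump decides the existential part, so \<open>good\<close> is universal over
    a predicate decidable from the jump, as \<open>path_degree_over_choice\<close> requires.\<close>
  from decidable_in_jump_ex[OF this[unfolded prod_decode_inverse]]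
  have "decidable_in (jump {}) (\<lambda>z. \<exists>B. Q (nfst z) (nsnd z) B)" .
  from path_degree_over_choice[OF P, of "\<lambda>a i. \<exists>B. Q a i B", OF this]
  obtain G where GP: "G \<le>\<^sub>T P"
    and G: "\<And>a b. good a \<or> good b \<Longrightarrow> good (if prod_encode (a, b) \<in> G then b else a)"
    unfolding good_def by metis
  \<comment> \<open>\<open>y\<close> is the current winner and \<open>i\<close> the challenger. Once
    a good candidate has taken part, every later winner is good.\<close>
  define sel where "sel t n = rec_nat 0 (\<lambda>i y. if prod_encode (prod_encode (t, y), prod_encode (t, i)) \<in> G
    then i else y) n" for t n
  have sel: "good (prod_encode (t, sel t n))" if "\<exists>u<n. good (prod_encode (t, u))" for t n
    using that
  proof (induction n)
    case (Suc n)
    then have "good (prod_encode (t, sel t n)) \<or> good (prod_encode (t, n))"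
      by (auto simp: less_Suc_eq)
    from G[OF this] show ?case by (simp add: sel_def split: if_splits)
  qed simp
  have "computable_in G (\<lambda>z. sel (nfst z) (nsnd z))"
    unfolding sel_def
    by (intro computable_in_rec computable_in_if computable_in_oracle computable_arith)
  from computable_on_comp[OF computable_in_imp_on[OF this, of UNIV] computable_on_pair[OF
        computable_in_imp_on[OF computable_in_id] computable_on_trans[OF N empty_turing_le]]]
  have "computable_on G D (\<lambda>t. sel t (N t))" by simp
  from computable_on_comp[OF computable_in_imp_on[OF computable_in_trans[OF nx empty_turing_le], of G UNIV]
      computable_on_pair[OF computable_in_imp_on[OF computable_in_id] this]]
  have c: "computable_on G D (\<lambda>t. nx (prod_encode (t, sel t (N t))))" by simp
  define s where "s j = ((\<lambda>t. nx (prod_encode (t, sel t (N t)))) ^^ j) t0" for j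
  have good: "good (prod_encode (t, sel t (N t)))" if "t \<in> D" for t
    using sel ex[OF that] unfolding good_def by blast
  then have nxD: "nx (prod_encode (t, sel t (N t))) \<in> D" if "t \<in> D" for t
    using step that unfolding good_def by blast
  have "computable_in G s"
    unfolding s_def by (rule computable_on_iterate[OF c t0 nxD])
  then have "computable_in P s" by (rule computable_in_trans[OF _ GP])
  moreover have sD: "s j \<in> D" for j
    by (induction j) (simp_all add: s_def t0 nxD)
  moreover have "s (Suc j) = nx (prod_encode (s j, sel (s j) (N (s j))))" for j
    by (simp add: s_def)
  moreover have "s 0 = t0" by (simp add: s_def)
  ultimately show ?thesis
    using good[OF sD] unfolding good_def by blast
qed

section \<open>Large sets\<close>

text \<open>A block is coded as a finite set together with a bound \<open>wid q\<close>, which is to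
  be one of the numbers witnessing \<open>packed\<close>.\<close>

abbreviation wid :: "nat \<Rightarrow> nat" where "wid q \<equiv> nfst q"

definition elems :: "nat \<Rightarrow> nat set" where "elems q = set_decode (nsnd q)"

text \<open>Besides bounding quantifiers over a block, this places the points of every block
  \<open>q < B\<close> below \<open>B\<close>.\<close>

lemma mem_elems_less: "x \<in> elems q \<Longrightarrow> x < q"
  using less_of_mem_set_decode[of x "nsnd q"] le_prod_encode_2[of "nsnd q" "nfst q"]
  by (simp add: elems_def)

locale bounded_colouring =
  fixes F :: "nat \<Rightarrow> nat \<Rightarrow> nat" and \<phi> :: "nat \<Rightarrow> nat" and k :: nat
  assumes F_le: "F x y \<le> k"
begin

definition homog :: "nat \<Rightarrow> nat \<Rightarrow> bool" where
  "homog c q \<longleftrightarrow> (\<forall>x\<in>elems q. \<forall>y\<in>elems q. x < y \<longrightarrow> F x y = c)"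

text \<open>Nonemptiness is a separate demand because \<open>\<phi> (wid q)\<close> may be 0; it
  makes the widths of successive blocks increase.\<close>

definition block :: "nat set \<Rightarrow> nat \<Rightarrow> nat \<Rightarrow> bool" where
  "block R m q \<longleftrightarrow> elems q \<noteq> {} \<and> (\<forall>x\<in>elems q. m < x \<and> x \<le> wid q \<and> x \<in> R) \<and>
     \<phi> (wid q) \<le> card (elems q) \<and> (\<exists>c\<le>k. homog c q)"

text \<open>One bound \<open>B\<close> serves all partitions into \<open>r + 1\<close> classes. Only
  the values of \<open>p\<close> below \<open>B\<close> matter, so \<open>hits\<close> is decidable
  for decidable \<open>R\<close>.\<close>

definition hits :: "nat set \<Rightarrow> nat \<Rightarrow> nat \<Rightarrow> nat \<Rightarrow> bool" where
  "hits R r m B \<longleftrightarrow> (\<forall>p. (\<forall>x. p x \<le> r) \<longrightarrow> (\<exists>q<B. block R m q \<and> (\<exists>j. \<forall>x\<in>elems q. p x = j)))"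

definition large :: "nat set \<Rightarrow> bool" where
  "large R \<longleftrightarrow> (\<forall>r m. \<exists>B. hits R r m B)"

text \<open>Numbering the labels lets partitions carry labels from any finite set, such as tuples of
  classes and colours.\<close>

lemma large_finite_range:
  fixes C :: "'a set"
  assumes "large R" and "finite C"
  shows "\<exists>B. \<forall>p. range p \<subseteq> C \<longrightarrow> (\<exists>q<B. block R m q \<and> (\<exists>j. \<forall>x\<in>elems q. p x = j))"
proof -
  obtain e :: "'a \<Rightarrow> nat" where e: "inj_on e C"
    using finite_imp_inj_to_nat_seg[OF assms(2)] by blast
  obtain r where "\<forall>v\<in>e ` C. v \<le> r"
    using assms(2) finite_nat_set_iff_bounded_le by blast
  then have r: "\<And>v. v \<in> C \<Longrightarrow> e v \<le> r" by blast
  obtain B where B: "hits R r m B"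
    using assms(1) unfolding large_def by blast
  have "\<exists>q<B. block R m q \<and> (\<exists>j. \<forall>x\<in>elems q. p x = j)" if p: "range p \<subseteq> C" for p
  proof -
    have "\<forall>x. e (p x) \<le> r" using p r by blast
    then obtain q j where q: "q < B" "block R m q" "\<forall>x\<in>elems q. e (p x) = j"
      using B[unfolded hits_def, rule_format, of "\<lambda>x. e (p x)"] by blast
    obtain x0 where "x0 \<in> elems q"
      using q(2) by (auto simp: block_def)
    then have "\<forall>x\<in>elems q. p x = p x0"
      using q(3) p e by (metis inj_onD range_subsetD)
    with q show ?thesis by blast
  qed
  then show ?thesis by blast
qed

lemma large_UNIV:
  assumes f: "f \<in> nsets UNIV 2 \<rightarrow> {1..k}" and Ff: "\<And>x y. x < y \<Longrightarrow> F x y = f {x, y}"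
    and arrows: "\<And>w. arrows w (\<phi> w) (k + 1)" and unbounded: "\<And>b. \<exists>w. b < \<phi> w"
  shows "large UNIV"
  unfolding large_def
proof (intro allI)
  fix r m
  \<comment> \<open>The classes formed below number at most \<open>r + m + 2\<close>:
    \<open>r + 1\<close> from \<open>p\<close> and \<open>m + 1\<close> from the points up to
    \<open>m\<close>.\<close>
  obtain w where w: "r + m + 2 < \<phi> w" using unbounded by blast
  \<comment> \<open>All blocks found below have width \<open>w\<close>, so their codes have a bound
    that does not depend on \<open>p\<close>.\<close>
  have "finite ((\<lambda>H. prod_encode (w, set_encode H)) ` Pow {1..w})" by simp
  then obtain B where B: "\<And>H. H \<subseteq> {1..w} \<Longrightarrow> prod_encode (w, set_encode H) < B"
    unfolding finite_nat_set_iff_bounded by blast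
  have "\<exists>q<B. block UNIV m q \<and> (\<exists>j. \<forall>x\<in>elems q. p x = j)" if p: "\<forall>x. p x \<le> r" for p
  proof -
    \<comment> \<open>The points up to \<open>m\<close> form classes of their own, and the colour \<open>k + 1\<close> marks pairs
      from different classes. There are fewer than \<open>\<phi> w\<close> classes, so a homogeneous set of
      size \<open>\<phi> w\<close> has a colour up to \<open>k\<close> and lies in one class.\<close>
    define c where "c x = (if x \<le> m then Suc r + x else p x)" for x
    define g where "g e = (if \<exists>v. c ` e \<subseteq> {v} then f e else k + 1)" for e
    have "g \<in> nsets {1..w} 2 \<rightarrow> {1..k + 1}"
    proof
      fix e assume "e \<in> nsets {1..w} 2"
      then have "e \<in> nsets UNIV 2" by (auto simp: nsets_def)
      then have "f e \<in> {1..k}" using f by (rule funcset_mem[rotated])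
      then show "g e \<in> {1..k + 1}" by (auto simp: g_def)
    qed
    then obtain \<xi> H where H: "H \<in> nsets {1..w} (\<phi> w)" and gH: "g ` nsets H 2 \<subseteq> {\<xi>}"
      using arrows[of w] unfolding arrows_def partn_def monochromatic_def by blast
    then have g: "g {x, y} = \<xi>" if "x \<in> H" "y \<in> H" "x \<noteq> y" for x y
      using gH that by (meson doubleton_in_nsets_2 image_subset_iff singletonD)
    have fin: "finite H" "H \<subseteq> {1..w}" "card H = \<phi> w"
      using H by (auto simp: nsets_def)
    have "c ` H \<subseteq> {..r + m + 1}" using p by (auto simp: c_def intro: le_SucI trans_le_add1)
    then have "card (c ` H) \<le> r + m + 2" using card_mono[of "{..r + m + 1}" "c ` H"] by simp
    then have "\<not> inj_on c H" using w fin by (metis card_image not_le)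
    then obtain x y where xy: "x \<in> H" "y \<in> H" "x \<noteq> y" "c x = c y"
      by (auto simp: inj_on_def)
    have "f {x, y} \<in> {1..k}"
      using f xy(3) by (auto simp: nsets_def Pi_iff)
    moreover have "g {x, y} = f {x, y}" using xy(4) by (auto simp: g_def)
    ultimately have \<xi>: "\<xi> \<le> k" using g[OF xy(1-3)] by auto
    have c_eq: "c a = c b \<and> f {a, b} = \<xi>" if "a \<in> H" "b \<in> H" "a \<noteq> b" for a b
      using g[OF that] \<xi> by (auto simp: g_def split: if_splits)
    have m: "m < a" if "a \<in> H" for a
    proof (rule ccontr)
      assume "\<not> m < a"
      moreover obtain b where b: "b \<in> H" "b \<noteq> a" using xy by blast
      moreover have "c a = c b" using c_eq that b by blast
      ultimately show False using p by (auto simp: c_def split: if_splits)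
          (metis Suc_n_not_le_n le_add1 add_Suc le_trans)
    qed
    define q where "q = prod_encode (w, set_encode H)"
    have q: "wid q = w" "elems q = H" using fin by (auto simp: q_def elems_def)
    have "block UNIV m q"
      unfolding block_def homog_def q using xy(1) m fin \<xi> c_eq Ff
      by (auto intro!: exI[of _ \<xi>])
    moreover have "\<forall>a\<in>elems q. p a = c x"
      unfolding q using c_eq[OF _ xy(1)] m by (metis c_def not_le)
    moreover have "q < B" using B fin by (auto simp: q_def)
    ultimately show ?thesis by blast
  qed
  then show "\<exists>B. hits UNIV r m B" unfolding hits_def by blast
qed

text \<open>If no extension works, combine the partitions refuting all of them with the partition of the
  points \<open>y\<close> according to the colours \<open>F x y\<close> for \<open>x < B\<close>; a block of \<open>R\<close> inside one part of
  the common refinement contradicts one of the refutations.\<close>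

lemma large_extend:
  assumes R: "large R" and B: "hits R k m B"
  shows "\<exists>q<B. \<exists>d\<le>k. block R m q \<and> large (R \<inter> {y. \<forall>x\<in>elems q. F x y = d})"
proof (rule ccontr)
  assume neg: "\<not> ?thesis"
  define I where "I = {(q, d). q < B \<and> d \<le> k \<and> block R m q}"
  define S where "S i = R \<inter> {y. \<forall>x\<in>elems (fst i). F x y = snd i}" for i
  have "finite I"
    by (rule finite_subset[of _ "{..<B} \<times> {..k}"]) (auto simp: I_def)
  have "\<forall>i\<in>I. \<exists>r m. \<forall>B'. \<not> hits (S i) r m B'"
    using neg by (auto simp: I_def S_def large_def)
  then obtain r' m' where nh: "\<And>i B'. i \<in> I \<Longrightarrow> \<not> hits (S i) (r' i) (m' i) B'"
    by metis
  define C where "C = PiE I (\<lambda>i. {..r' i}) \<times> PiE {..<B} (\<lambda>x. {..k})"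
  have "finite C"
    using \<open>finite I\<close> by (auto simp: C_def intro!: finite_PiE)
  \<comment> \<open>A block beyond \<open>M\<close> is beyond the thresholds of all the
    refutations.\<close>
  obtain M where M: "\<And>i. i \<in> I \<Longrightarrow> m' i \<le> M"
    using \<open>finite I\<close> finite_nat_set_iff_bounded_le[of "m' ` I"] by blast
  obtain B' where B': "\<And>p. range p \<subseteq> C \<Longrightarrow> \<exists>q<B'. block R M q \<and> (\<exists>j. \<forall>x\<in>elems q. p x = j)"
    using large_finite_range[OF R \<open>finite C\<close>] by blast
  have "\<forall>i\<in>I. \<exists>p. (\<forall>x. p x \<le> r' i) \<and> \<not> (\<exists>q<B'. block (S i) (m' i) q \<and> (\<exists>j. \<forall>x\<in>elems q. p x = j))"
    using nh unfolding hits_def by blast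
  then obtain P where P: "\<And>i x. i \<in> I \<Longrightarrow> P i x \<le> r' i"
    and noq: "\<And>i q j. i \<in> I \<Longrightarrow> q < B' \<Longrightarrow> block (S i) (m' i) q \<Longrightarrow> \<not> (\<forall>x\<in>elems q. P i x = j)"
    by metis
  define p where "p y = (restrict (\<lambda>i. P i y) I, restrict (\<lambda>x. F x y) {..<B})" for y
  have "range p \<subseteq> C"
    by (simp add: p_def C_def image_subset_iff restrict_PiE_iff P F_le)
  from B'[OF this] obtain q' j where q': "q' < B'" "block R M q'" and j: "\<And>y. y \<in> elems q' \<Longrightarrow> p y = j"
    by blast
  obtain y0 where y0: "y0 \<in> elems q'" using q'(2) by (auto simp: block_def)
  have p_eq: "p y = p y0" if "y \<in> elems q'" for y using j y0 that by simp
  have Peq: "P i y = P i y0" if "y \<in> elems q'" "i \<in> I" for i y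
    using arg_cong[OF p_eq[OF that(1)], of "\<lambda>z. fst z i"] that(2) by (simp add: p_def)
  have Feq: "F x y = F x y0" if "y \<in> elems q'" "x < B" for x y
    using arg_cong[OF p_eq[OF that(1)], of "\<lambda>z. snd z x"] that(2) by (simp add: p_def)
  \<comment> \<open>Colour each \<open>x\<close> by \<open>F x y0\<close>. Some block
    \<open>q < B\<close> is constant for this, and as its points are below \<open>B\<close>, they
    see the same colour on all of the block \<open>q'\<close>.\<close>
  obtain q d where q: "q < B" "block R m q" and d: "\<And>x. x \<in> elems q \<Longrightarrow> F x y0 = d"
    using B[unfolded hits_def, rule_format, of "\<lambda>x. F x y0"] F_le by blast
  have lt: "x < B" if "x \<in> elems q" for x
    using mem_elems_less[OF that] q(1) by simp
  have "d \<le> k" using d q(2) F_le by (auto simp: block_def)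
  then have i: "(q, d) \<in> I" using q by (simp add: I_def)
  have "y \<in> S (q, d)" if "y \<in> elems q'" for y
    using that q'(2) d lt Feq[OF that] by (auto simp: S_def block_def)
  then have "block (S (q, d)) (m' (q, d)) q'"
    using q'(2) M[OF i] unfolding block_def by (meson le_less_trans)
  from noq[OF i q'(1) this] Peq i show False by blast
qed

end

section \<open>The sequence of blocks\<close>

text \<open>Codes a partition of the points below \<open>n\<close> by base \<open>r + 1\<close>
  digits, so that quantifying over partitions becomes quantifying over bounded numbers.\<close>

lemma ex_digits: "\<forall>x. p x \<le> r \<Longrightarrow> \<exists>e<Suc r ^ n. \<forall>x<n. e div Suc r ^ x mod Suc r = p x"
proof (induction n)
  case (Suc n)
  then obtain e where e: "e < Suc r ^ n" "\<forall>x<n. e div Suc r ^ x mod Suc r = p x" by blast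
  have "p n \<le> r" using Suc.prems by blast
  let ?e = "e + p n * Suc r ^ n"
  have "?e < Suc r ^ Suc n"
    using e(1) mult_le_mono1[OF \<open>p n \<le> r\<close>, of "Suc r ^ n"] by (simp add: add_less_le_mono)
  moreover have "?e div Suc r ^ x mod Suc r = p x" if "x < Suc n" for x
  proof (cases "x = n")
    case True
    then show ?thesis using e(1) \<open>p n \<le> r\<close> by simp
  next
    case False
    then have "x < n" using that by simp
    then have "Suc r ^ n = Suc r ^ x * (Suc r * Suc r ^ (n - Suc x))"
      by (metis Suc_diff_Suc le_add_diff_inverse less_imp_le power_Suc power_add)
    then have "?e div Suc r ^ x = e div Suc r ^ x + Suc r * (p n * Suc r ^ (n - Suc x))"
      by (simp only: mult.assoc mult.left_commute[of "p n"]) simp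
    then show ?thesis using e(2) \<open>x < n\<close> by (simp only: mod_mult_self2)
  qed
  ultimately show ?case by blast
qed simp

text \<open>The case distinction avoids a carry: adding \<open>2 ^ v\<close> to a code that already
  contains \<open>v\<close> would remove \<open>v\<close>.\<close>

definition code_insert :: "nat \<Rightarrow> nat \<Rightarrow> nat" where
  "code_insert v s = (if v \<in> set_decode s then s else 2 ^ v + s)"

lemma set_decode_code_insert: "set_decode (code_insert v s) = insert v (set_decode s)"
  by (auto simp: code_insert_def set_decode_plus_power_2)

locale computable_colouring = bounded_colouring +
  assumes computable_F: "computable_in {} (\<lambda>z. F (nfst z) (nsnd z))"
    and computable_phi: "computable_in {} \<phi>"
begin

text \<open>A number \<open>v\<close> stands for the block \<open>v div Suc k\<close> together with the colour \<open>v mod Suc k\<close>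
  of all pairs from this block to later blocks. A state is a pair of the last choice and the
  code of the set of all choices made so far.\<close>

definition reservoir :: "nat \<Rightarrow> nat set" where
  "reservoir s = {y. \<forall>v\<in>set_decode s. \<forall>x\<in>elems (v div Suc k). F x y = v mod Suc k}"

text \<open>At the initial state 0 this is 0, so the first block already consists of positive
  numbers.\<close>

definition last_wid :: "nat \<Rightarrow> nat" where "last_wid t = wid (nfst t div Suc k)"

section \<open>Decidability of reservoirs, blocks and \<open>hits\<close>\<close>

lemma reservoir_code_insert:
  "reservoir (code_insert v s) = reservoir s \<inter> {y. \<forall>x\<in>elems (v div Suc k). F x y = v mod Suc k}"
  by (auto simp: reservoir_def set_decode_code_insert)

lemma computable_in_F:
  "computable_in {} f \<Longrightarrow> computable_in {} g \<Longrightarrow> computable_in {} (\<lambda>n. F (f n) (g n))"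
  using computable_in_comp[OF computable_F computable_in_pair, of f g] by simp

lemma decidable_in_elems:
  "computable_in X f \<Longrightarrow> computable_in X g \<Longrightarrow> decidable_in X (\<lambda>n. f n \<in> elems (g n))"
  unfolding elems_def by (intro computable_intros)

lemma decidable_in_reservoir:
  assumes "computable_in {} f" and "computable_in {} g"
  shows "decidable_in {} (\<lambda>n. f n \<in> reservoir (g n))"
proof -
  have "x \<in> elems (v div Suc k) \<Longrightarrow> x < v" for x v
    using mem_elems_less div_le_dividend less_le_trans by blast
  then have "y \<in> reservoir s \<longleftrightarrow> (\<forall>v<s. v \<in> set_decode s \<longrightarrow>
      (\<forall>x<v. x \<in> elems (v div Suc k) \<longrightarrow> F x y = v mod Suc k))" for y s
    using less_of_mem_set_decode by (auto simp: reservoir_def)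
  then show ?thesis
    by (simp only:) (intro computable_intros assms assms[THEN computable_in_comp] decidable_in_elems computable_in_F)
qed

lemma decidable_in_homog:
  assumes "computable_in {} f" and "computable_in {} g"
  shows "decidable_in {} (\<lambda>n. homog (f n) (g n))"
proof -
  have "homog c q \<longleftrightarrow> (\<forall>x<q. \<forall>y<q. x \<in> elems q \<and> y \<in> elems q \<and> x < y \<longrightarrow> F x y = c)" for c q
    using mem_elems_less by (auto simp: homog_def)
  then show ?thesis
    by (simp only:) (intro computable_intros assms assms[THEN computable_in_comp] decidable_in_elems computable_in_F)
qed

lemma decidable_in_block:
  assumes "computable_in {} f" and "computable_in {} g" and "computable_in {} h"
  shows "decidable_in {} (\<lambda>n. block (reservoir (f n)) (g n) (h n))"
proof -
  have "block R m q \<longleftrightarrow> (\<exists>x<q. x \<in> elems q) \<and>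
      (\<forall>x<q. x \<in> elems q \<longrightarrow> m < x \<and> x \<le> wid q \<and> x \<in> R) \<and>
      \<phi> (wid q) \<le> card (set_decode (nsnd q)) \<and> (\<exists>c\<le>k. homog c q)" for R m q
    using mem_elems_less by (auto simp: block_def elems_def[symmetric])
  then show ?thesis
    by (simp only:) (intro computable_intros assms assms[THEN computable_in_comp] decidable_in_elems decidable_in_reservoir
        decidable_in_homog computable_in_card_set_decode computable_in_comp[OF computable_phi])
qed

text \<open>By \<open>ex_digits\<close> and \<open>mem_elems_less\<close> the partitions can be
  replaced by the digit sequences of the numbers \<open>e < Suc r ^ B\<close>; \<open>j\<close> is
  at most \<open>r\<close> because a block is nonempty.\<close>

lemma decidable_in_hits:
  assumes "computable_in {} f" and "computable_in {} r" and "computable_in {} m"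
    and "computable_in {} b"
  shows "decidable_in {} (\<lambda>n. hits (reservoir (f n)) (r n) (m n) (b n))"
proof -
  have "hits R r m B \<longleftrightarrow> (\<forall>e<Suc r ^ B. \<exists>q<B. block R m q \<and>
      (\<exists>j\<le>r. \<forall>x<q. x \<in> elems q \<longrightarrow> e div Suc r ^ x mod Suc r = j))" (is "_ \<longleftrightarrow> ?rhs")
    for R r m B
  proof
    assume h: "hits R r m B"
    show ?rhs
    proof (intro allI impI)
      fix e
      have le: "e div Suc r ^ x mod Suc r \<le> r" for x
        using mod_less_divisor[of "Suc r"] by (simp add: less_Suc_eq_le)
      then obtain q j where q: "q < B" "block R m q" "\<forall>x\<in>elems q. e div Suc r ^ x mod Suc r = j"
        using h[unfolded hits_def, rule_format, of "\<lambda>x. e div Suc r ^ x mod Suc r"] by blast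
      moreover have "j \<le> r" using q(2,3) le by (auto simp: block_def)
      ultimately show "\<exists>q<B. block R m q \<and>
          (\<exists>j\<le>r. \<forall>x<q. x \<in> elems q \<longrightarrow> e div Suc r ^ x mod Suc r = j)" by blast
    qed
  next
    assume rhs: ?rhs
    show "hits R r m B"
      unfolding hits_def
    proof (intro allI impI)
      fix p :: "nat \<Rightarrow> nat" assume "\<forall>x. p x \<le> r"
      then obtain e where e: "e < Suc r ^ B" "\<forall>x<B. e div Suc r ^ x mod Suc r = p x"
        using ex_digits by blast
      obtain q j where q: "q < B" "block R m q"
        "\<forall>x<q. x \<in> elems q \<longrightarrow> e div Suc r ^ x mod Suc r = j"
        using rhs e(1) by blast
      have "\<forall>x\<in>elems q. p x = j"
        using q e(2) mem_elems_less by (metis less_trans)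
      with q show "\<exists>q<B. block R m q \<and> (\<exists>j. \<forall>x\<in>elems q. p x = j)" by blast
    qed
  qed
  then show ?thesis
    by (simp only:) (intro computable_intros assms assms[THEN computable_in_comp] decidable_in_elems decidable_in_block)
qed

section \<open>Construction of the blocks and of the packed set\<close>

lemma ex_block_sequence:
  assumes P: "P \<ggreater> jump {}" and large_UNIV: "large UNIV"
  obtains s where "computable_in P s"
    and "\<And>j. block (reservoir (nsnd (s j))) (last_wid (s j)) (nfst (s (Suc j)) div Suc k)"
    and "\<And>j. nsnd (s (Suc j)) = code_insert (nfst (s (Suc j))) (nsnd (s j))"
proof -
  \<comment> \<open>The index \<open>i\<close> codes the pair of \<open>r\<close> and
    \<open>m\<close> in \<open>large\<close>, and \<open>B\<close> is the bound in
    \<open>hits\<close>.\<close>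
  define Q where "Q a i B \<longleftrightarrow>
      block (reservoir (nsnd (nfst a))) (last_wid (nfst a)) (nsnd a div Suc k) \<and>
      hits (reservoir (code_insert (nsnd a) (nsnd (nfst a)))) (nfst i) (nsnd i) B" for a i B
  define D where "D = {t. large (reservoir (nsnd t))}"
  \<comment> \<open>By \<open>large_extend\<close> some suitable block lies below the least such
    \<open>B\<close>; a choice combines it with one of \<open>Suc k\<close> colours.\<close>
  define N where "N t = (LEAST B. hits (reservoir (nsnd t)) k (last_wid t) B) * Suc k" for t
  define nx where "nx a = prod_encode (nsnd a, code_insert (nsnd a) (nsnd (nfst a)))" for a
  have Q_iff: "(\<forall>i. \<exists>B. Q (prod_encode (t, v)) i B) \<longleftrightarrow>
      block (reservoir (nsnd t)) (last_wid t) (v div Suc k) \<and> large (reservoir (code_insert v (nsnd t)))"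
    for t v
    unfolding Q_def large_def by (simp) (metis prod_encode_inverse fst_conv snd_conv)
  have dQ: "decidable_in {} (\<lambda>z. Q (nfst z) (nfst (nsnd z)) (nsnd (nsnd z)))"
    unfolding Q_def last_wid_def code_insert_def
    by (intro computable_intros decidable_in_block decidable_in_hits)
  have ex: "\<exists>B. hits (reservoir (nsnd t)) k (last_wid t) B" if "t \<in> D" for t
    using that by (auto simp: D_def large_def)
  have least: "computable_on {} D (\<lambda>t. LEAST B. hits (reservoir (nsnd t)) k (last_wid t) B)"
    using ex unfolding last_wid_def
    by (intro computable_on_Least) (intro computable_intros decidable_in_hits, simp)
  have "computable_on {} UNIV (\<lambda>b. b * Suc k)"
    by (intro computable_in_imp_on computable_intros)
  from computable_on_comp[OF this least] have dN: "computable_on {} D N"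
    unfolding N_def by simp
  have dnx: "computable_in {} nx"
    unfolding nx_def code_insert_def by (intro computable_intros)
  \<comment> \<open>The initial state 0 is the pair (0, 0): no choices have been made, and the
    reservoir is everything.\<close>
  have "nsnd 0 = 0"
    using prod_encode_inverse[of "(0, 0)"] by (simp add: prod_encode_def)
  then have D0: "0 \<in> D"
    using large_UNIV by (simp add: D_def reservoir_def)
  have "\<exists>v<N t. \<forall>i. \<exists>B. Q (prod_encode (t, v)) i B" if t: "t \<in> D" for t
  proof -
    let ?R = "reservoir (nsnd t)" and ?B = "LEAST B. hits (reservoir (nsnd t)) k (last_wid t) B"
    have "hits ?R k (last_wid t) ?B" using ex[OF t] by (rule LeastI_ex)
    then obtain q d where q: "q < ?B" "d \<le> k" "block ?R (last_wid t) q"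
      and large: "large (?R \<inter> {y. \<forall>x\<in>elems q. F x y = d})"
      using large_extend[of ?R] t unfolding D_def by blast
    define v where "v = q * Suc k + d"
    have v: "v div Suc k = q" "v mod Suc k = d"
      using q(2) by (simp_all only: v_def div_mult_self3 mod_mult_self3) simp_all
    have "v < Suc q * Suc k" using q(2) by (simp add: v_def)
    also have "\<dots> \<le> N t" unfolding N_def using q(1) by (intro mult_le_mono1) simp
    finally have "v < N t" .
    moreover have "\<forall>i. \<exists>B. Q (prod_encode (t, v)) i B"
      unfolding Q_iff reservoir_code_insert v using q large by blast
    ultimately show ?thesis by blast
  qed
  moreover have "nx (prod_encode (t, v)) \<in> D" if "\<forall>i. \<exists>B. Q (prod_encode (t, v)) i B" for t v
    using that unfolding Q_iff by (simp add: D_def nx_def)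
  ultimately obtain s where sP: "computable_in P s" and s: "\<And>j. \<exists>v. (\<forall>i. \<exists>B. Q (prod_encode (s j, v)) i B)
      \<and> s (Suc j) = nx (prod_encode (s j, v))"
    using dependent_choice_computable[OF P dQ dN dnx D0] by blast
  have "block (reservoir (nsnd (s j))) (last_wid (s j)) (nfst (s (Suc j)) div Suc k)"
    "nsnd (s (Suc j)) = code_insert (nfst (s (Suc j))) (nsnd (s j))" for j
    using s[of j] unfolding Q_iff by (auto simp: nx_def)
  with sP show thesis by (rule that)
qed

lemma ex_packed_semi_homogeneous:
  assumes P: "P \<ggreater> jump {}" and large_UNIV: "large UNIV"
  obtains A c d where "A \<le>\<^sub>T P" and "packed \<phi> A"
    and "\<And>x y. x \<in> A \<Longrightarrow> y \<in> A \<Longrightarrow> x < y \<Longrightarrow> F x y = c \<or> F x y = d"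
proof -
  obtain s where s: "computable_in P s"
    and blk: "\<And>j. block (reservoir (nsnd (s j))) (last_wid (s j)) (nfst (s (Suc j)) div Suc k)"
    and ins: "\<And>j. nsnd (s (Suc j)) = code_insert (nfst (s (Suc j))) (nsnd (s j))"
    using ex_block_sequence[OF assms] by metis
  \<comment> \<open>State 0 records no block: block \<open>j\<close> is chosen from the reservoir of
    state \<open>j\<close> and recorded in state \<open>j + 1\<close>.\<close>
  define v where "v j = nfst (s (Suc j))" for j
  define q where "q j = v j div Suc k" for j
  define d where "d j = v j mod Suc k" for j
  have mem: "v i \<in> set_decode (nsnd (s j))" if "i < j" for i j
    using that by (induction j) (auto simp: ins set_decode_code_insert v_def less_Suc_eq)
  have cross: "F x y = d i" if "x \<in> elems (q i)" "y \<in> elems (q j)" "i < j" for x y i j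
  proof -
    have "y \<in> reservoir (nsnd (s j))"
      using blk[of j] that(2) by (auto simp: block_def q_def v_def)
    then show ?thesis
      using mem[OF that(3)] that(1) by (auto simp: reservoir_def q_def d_def)
  qed
  have bounds: "last_wid (s j) < x \<and> x \<le> wid (q j)" if "x \<in> elems (q j)" for x j
    using blk[of j] that by (auto simp: block_def q_def v_def)
  have last_wid_Suc: "last_wid (s (Suc j)) = wid (q j)" for j
    by (simp add: last_wid_def q_def v_def)
  have nonempty: "elems (q j) \<noteq> {}" for j
    using blk[of j] by (simp add: block_def q_def v_def)
  have "last_wid (s j) < last_wid (s (Suc j))" for j
    using bounds[of _ j] nonempty[of j] unfolding last_wid_Suc by fastforce
  then have mono: "strict_mono (\<lambda>j. last_wid (s j))"
    by (simp add: strict_mono_Suc_iff)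
  have less: "x < y" if "x \<in> elems (q i)" "y \<in> elems (q j)" "i < j" for x y i j
  proof -
    have "wid (q i) \<le> last_wid (s j)"
      using strict_mono_less_eq[OF mono, of "Suc i" j] that(3) by (simp add: last_wid_Suc)
    then show ?thesis using bounds[OF that(1)] bounds[OF that(2)] by linarith
  qed
  \<comment> \<open>Bounds the search for the block containing a given point when \<open>A\<close>
    is decided.\<close>
  have index: "j < x" if "x \<in> elems (q j)" for x j
    using bounds[OF that] strict_mono_imp_increasing[OF mono, of j] by linarith
  have "\<exists>c\<le>k. homog c (q j)" for j
    using blk[of j] by (simp add: block_def q_def v_def)
  then obtain c where c: "\<And>j. c j \<le> k" "\<And>j. homog (c j) (q j)" by metis
  have "range (\<lambda>j. (c j, d j)) \<subseteq> {..k} \<times> {..k}"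
    using c(1) mod_less_divisor[of "Suc k"] by (auto simp: d_def less_Suc_eq_le)
  then have "finite (range (\<lambda>j. (c j, d j)))"
    by (rule finite_subset) simp
  then obtain c0 d0 where "infinite ((\<lambda>j. (c j, d j)) -` {(c0, d0)})"
    using inf_img_fin_dom[of "\<lambda>j. (c j, d j)" UNIV] by auto
  \<comment> \<open>\<open>homog c0\<close> is decidable, whereas \<open>c\<close> was merely
    chosen; membership in \<open>J\<close> is thus decided from \<open>v\<close> and two
    constants.\<close>
  moreover define J where "J = {j. homog c0 (q j) \<and> d j = d0}"
  ultimately have J: "infinite J"
    using c(2) by (elim infinite_super[rotated]) auto
  define A where "A = (\<Union>j\<in>J. elems (q j))"
  have "A \<le>\<^sub>T P"
  proof -
    have v: "computable_in P v"
      unfolding v_def by (intro computable_arith computable_in_comp[OF s])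
    have "decidable_in P (\<lambda>z. homog c0 z)"
      by (rule decidable_in_trans[OF _ empty_turing_le]) (intro decidable_in_homog computable_arith)
    note homog = decidable_in_comp[OF this]
    have "x \<in> A \<longleftrightarrow> (\<exists>j<x. homog c0 (q j) \<and> d j = d0 \<and> x \<in> elems (q j))" for x
      using index by (auto simp: A_def J_def)
    then show ?thesis
      unfolding turing_le_iff q_def d_def
      by (simp only:) (intro computable_intros homog decidable_in_elems computable_in_comp[OF v])
  qed
  moreover have "packed \<phi> A"
    unfolding packed_def
  proof (rule infinite_super)
    \<comment> \<open>Infinitely many blocks have infinitely many widths, and each width witnesses
      packedness through its own block.\<close>
    have "strict_mono (\<lambda>j. wid (q j))"
      using mono unfolding strict_mono_def last_wid_Suc[symmetric] by simp
    then show "infinite ((\<lambda>j. wid (q j)) ` J)"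
      using J by (simp add: finite_image_iff strict_mono_on_imp_inj_on strict_mono_imp_inj_on inj_on_subset)
    show "(\<lambda>j. wid (q j)) ` J \<subseteq> {w. \<phi> w \<le> card (A \<inter> {1..w})}"
    proof clarify
      fix j assume "j \<in> J"
      then have "elems (q j) \<subseteq> A \<inter> {1..wid (q j)}"
        using bounds by (fastforce simp: A_def)
      then have "card (elems (q j)) \<le> card (A \<inter> {1..wid (q j)})"
        by (intro card_mono) auto
      then show "\<phi> (wid (q j)) \<le> card (A \<inter> {1..wid (q j)})"
        using blk[of j] by (simp add: block_def q_def v_def)
    qed
  qed
  moreover have "F x y = c0 \<or> F x y = d0" if xy: "x \<in> A" "y \<in> A" "x < y" for x y
  proof -
    obtain i j where ij: "x \<in> elems (q i)" "y \<in> elems (q j)" "i \<in> J" "j \<in> J"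
      using xy by (auto simp: A_def)
    consider "i = j" | "i < j" | "j < i" by linarith
    then show ?thesis
    proof cases
      case 1
      then show ?thesis using ij xy(3) by (auto simp: J_def homog_def)
    next
      case 2
      then show ?thesis using cross[OF ij(1,2)] ij(3) by (simp add: J_def)
    next
      case 3
      then show ?thesis using less[OF ij(2,1)] xy(3) by simp
    qed
  qed
  ultimately show thesis by (rule that)
qed

end

section \<open>The theorem for colourings of pairs\<close>

theorem theorem2p9:
  fixes k :: nat and f :: "nat set \<Rightarrow> nat" and \<phi> :: "nat \<Rightarrow> nat" and P :: "nat set"
  assumes "f \<in> nsets UNIV 2 \<rightarrow> {1..k}"
    and "computable_on_pairs f"
    and "computable \<phi>"
    and "\<And>w. arrows w (\<phi> w) (k + 1)"
    and "liminf (\<lambda>w. enat (\<phi> w)) = \<infinity>"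
    and "P \<ggreater> jump {}"
  shows "\<exists>A. A \<le>\<^sub>T P \<and> packed \<phi> A \<and> semi_homogeneous f A"
proof -
  obtain g where g: "computable g" and fg: "\<And>x y. x < y \<Longrightarrow> f {x, y} = g (prod_encode (x, y))"
    using assms(2) by (auto simp: computable_on_pairs_def)
  \<comment> \<open>Where \<open>x < y\<close> fails, the value 0 keeps \<open>F\<close> total,
    computable and at most \<open>k\<close>.\<close>
  define F where "F x y = (if x < y then g (prod_encode (x, y)) else 0)" for x y
  have Ff: "F x y = f {x, y}" if "x < y" for x y
    using that by (simp add: F_def fg)
  interpret computable_colouring F \<phi> k
  proof
    show "F x y \<le> k" for x y
    proof (cases "x < y")
      case True
      then have "f {x, y} \<in> {1..k}" using assms(1) by (intro funcset_mem[OF assms(1)]) simp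
      then show ?thesis using Ff[OF True] by simp
    qed (simp add: F_def)
    show "computable_in {} (\<lambda>z. F (nfst z) (nsnd z))"
      unfolding F_def
      by (intro computable_intros computable_in_comp[OF computable_imp_computable_in[OF g]])
    show "computable_in {} \<phi>"
      using assms(3) by (rule computable_imp_computable_in)
  qed
  have "\<exists>w. b < \<phi> w" for b
  proof -
    have "\<forall>y<\<infinity>. eventually (\<lambda>w. y < enat (\<phi> w)) sequentially"
      using assms(5) by (simp only: le_Liminf_iff[symmetric])
    from this[rule_format, of "enat b"] show ?thesis by (auto simp: eventually_sequentially)
  qed
  from large_UNIV[OF assms(1) Ff assms(4) this] have "large UNIV" .
  then obtain A c d where A: "A \<le>\<^sub>T P" "packed \<phi> A"
    and cd: "\<And>x y. x \<in> A \<Longrightarrow> y \<in> A \<Longrightarrow> x < y \<Longrightarrow> F x y = c \<or> F x y = d"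
    using ex_packed_semi_homogeneous[OF assms(6)] by blast
  have sub: "f ` nsets A 2 \<subseteq> {c, d}"
  proof
    fix z assume "z \<in> f ` nsets A 2"
    then obtain x y where "z = f {x, y}" "x \<in> A" "y \<in> A" "x \<noteq> y"
      by (auto elim!: nsets2_E)
    then show "z \<in> {c, d}"
      using cd[of x y] cd[of y x] Ff[of x y] Ff[of y x]
      by (cases x y rule: linorder_cases) (simp_all add: insert_commute)
  qed
  have "card {c, d} \<le> 2" by (cases "c = d") auto
  then have "semi_homogeneous f A"
    unfolding semi_homogeneous_def using card_mono[OF _ sub] finite_subset[OF sub] by simp
  with A show ?thesis by blast
qed

end
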